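(* Let $\mathcal{D}'$ be a subalgebra with unit of the algebra $\mathcal{D}$ of proper pseudo-differential boundary value operators, let $A$ be a left $\mathcal{D}'$-module, let $\overline N,\overline N_1$ be positive integers, and let $\mathcal{L}\in\mathcal{D}'(\overline N_1\times\overline N)$. Suppose that there exists a matrix $\mathcal{P}\in\mathcal{D}'(\overline N\times\overline N_1)$ such that $$\mathcal{L}\mathcal{P}\mathcal{L}=\mathcal{L}.$$ Then the control system $\mathcal{L}X=0$ is $\mathcal{D}'$-parametrizable in $A^{\overline N}$; that is, there exist a positive integer $\overline N'$ and a matrix $\mathcal{S}\in\mathcal{D}'(\overline N\times\overline N')$ such that for every $X\in A^{\overline N}$: $\mathcal{L}X=0$ if and only if $X=\mathcal{S}X'$ for some $X'\in A^{\overline N'}$.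
   Context: **The operator algebra $\mathcal{D}$.** $G\subset\mathbb{R}^n$ is a bounded open set whose closure $\overline G$ is a smooth manifold with orientable boundary $\partial G$; $\Delta\subset\mathbb{R}$ is an interval; $\nu>0$ is fixed; $\mathcal{R}=C^\infty(\overline G\times\Delta)\oplus C^\infty(\partial G\times\Delta)$ (complex-valued smooth functions). Elements of $\mathcal{D}$ are linear maps $\mathcal{R}\to\mathcal{R}$ of the form $\begin{pmatrix} r^+A+B&K\\ T&Q\end{pmatrix}$ where the kernels of all entries have proper supports and the entries are, in local coordinates (via a partition of unity, replacing $\overline G$ by $G'\times\overline{\mathbb{R}}_+$ and $\partial G$ by $G'$, with $G'\subset\mathbb{R}^{n-1}$ open, $x=(x',x_n)$, $\xi=(\xi',\xi_n)$), of the types below, of arbitrary order $m$ and class $d\in\mathbb{N}_0$. Put $\rho(\xi,\eta)=(1+|\xi|^2+|\eta|^{2/\nu})^{1/2}$ and $\rho'=\rho(\xi',\eta)=(1+|\xi'|^2+|\eta|^{2/\nu})^{1/2}$. $S^m_\nu(G'\times\overline{\mathbb{R}}_+\times\Delta\times\mathbb{R}^{n+1})$ is the space of smooth $a(x,t,\xi,\eta)$ such that for every compact $H$ in $G'\times\overline{\mathbb{R}}_+\times\Delta$ and all $\alpha,\beta,j,l$ one has $|\partial_x^\alpha\partial_t^j\partial_\xi^\beta\partial_\eta^l a|\le C\rho(\xi,\eta)^{m-|\beta|-\nu l}$ on $H\times\mathbb{R}^{n+1}$; $S^m_\nu(G'\times\Delta\times\mathbb{R}^n)$ and $S^m_\nu(G'\times\overline{\mathbb{R}}_+\times\Delta\times\mathbb{R}^n)$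 are defined likewise with covariables $(\xi',\eta)$ and $\rho'$ in place of $\rho(\xi,\eta)$. A sequence is rapidly decreasing in such a space if every seminorm of its $k$-th term is $O((1+|k|)^{-M})$ for all $M$ (similarly for double sequences). $e^+$ is extension by zero to $x_n<0$, $r^+$ restriction to $x_n>0$; $\hat{\ }$ is the Fourier transform $\hat u(\xi)=\int u(x)e^{-i\langle x,\xi\rangle}dx$; $\int^+f\,d\xi_n=\lim_{R\to\infty}\oint_{\Gamma_R}f(z)\,dz$ with $\Gamma_R$ the counterclockwise boundary of $\{|z|<R,\ \mathrm{Im}\,z>0\}$. - $r^+Av(x,t)=(2\pi)^{-(n+1)}r^+\int\int e^{i\langle(x,t),(\xi,\eta)\rangle}a(x,t,\xi,\eta)\widehat{e^+v}(\xi,\eta)\,d\xi\,d\eta$, with $a\in S^m_\nu(G'\times\overline{\mathbb{R}}_+\times\Delta\times\mathbb{R}^{n+1})$ satisfying the transmission condition: for all $\gamma\in\mathbb{N}_0$, $\partial_{x_n}^\gamma a|_{x_n=0}=\sum_{p=0}^m\alpha_{\gamma p}(x',t,\xi',\eta)\xi_n^p+\sum_{k=-\infty}^\infty a_{\gamma k}(x',t,\xi',\eta)\frac{(\rho'-i\xi_n)^k}{(\rho'+i\xi_n)^{k+1}}$, with $\alpha_{\gamma p}\in S^{m-p}_\nu(G'\times\Delta\times\mathbb{R}^n)$ and $(a_{\gamma k})_k$ rapidly decreasing in $S^{m+1}_\nu(G'\times\Delta\times\mathbb{R}^n)$. - Potential operator: $Kw(x,t)=(2\pi)^{-(n+1)}\int\int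 e^{i\langle(x,t),(\xi,\eta)\rangle}k(x,t,\xi',\xi_n,\eta)\hat w(\xi',\eta)\,d\xi\,d\eta$, $k=\sum_{k=0}^\infty a_k(x,t,\xi',\eta)\frac{(\rho'-i\xi_n)^k}{(\rho'+i\xi_n)^{k+1}}$, $(a_k)$ rapidly decreasing in $S^{m+1}_\nu(G'\times\overline{\mathbb{R}}_+\times\Delta\times\mathbb{R}^n)$. - Trace operator: $Tv(x',t)=(2\pi)^{-n}\int\int e^{i\langle(x',t),(\xi',\eta)\rangle}\int^+\tau(x',t,\xi',\xi_n,\eta)\widehat{e^+v}(\xi,\eta)\,d\xi_n\,d\xi'\,d\eta$, $\tau=\sum_{p=0}^{d-1}\alpha_p(x',t,\xi',\eta)\xi_n^p+\sum_{k=0}^\infty a_k(x',t,\xi',\eta)\frac{(\rho'+i\xi_n)^k}{(\rho'-i\xi_n)^{k+1}}$, $\alpha_p\in S^{m-p}_\nu(G'\times\Delta\times\mathbb{R}^n)$, $(a_k)$ rapidly decreasing in $S^{m+1}_\nu(G'\times\Delta\times\mathbb{R}^n)$. - Green operator: $Bv(x,t)=(2\pi)^{-n-1}\int\int e^{i\langle(x,t),(\xi,\eta)\rangle}\int^+b(x,t,\xi',\xi_n,\zeta_n,\eta)\widehat{e^+v}(\xi',\zeta_n,\eta)\,d\zeta_n\,d\xi\,d\eta$, $b=\sum_{p=0}^{d-1}k_p(x,t,\xi',\xi_n,\eta)\zeta_n^p+\sum_{j,l\ge0}a_{jl}(x',t,\xi',\eta)\frac{(\rho'-i\xi_n)^j}{(\rho'+i\xi_n)^{j+1}}\frac{(\rho'+i\zeta_n)^l}{(\rho'-i\zeta_n)^{l+1}}$,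 $k_p$ potential symbols of order $m-p$, $(a_{jl})$ rapidly decreasing in $S^{m+2}_\nu(G'\times\Delta\times\mathbb{R}^n)$. - $Qw(x',t)=(2\pi)^{-n}\int\int e^{i\langle(x',t),(\xi',\eta)\rangle}q(x',t,\xi',\eta)\hat w(\xi',\eta)\,d\xi'\,d\eta$, $q\in S^m_\nu(G'\times\Delta\times\mathbb{R}^n)$. $\mathcal{D}$ is an algebra under addition and composition of operators (taken as known). **Algebraic notation.** $\mathcal{D}'\subset\mathcal{D}$ is a (not necessarily commutative) subalgebra, i.e. closed under linear combinations and composition, possessing a unit element $\mathcal{I}$. Modules over $\mathcal{D}'$ are left unitary modules. $\mathcal{D}'(p\times q)$ is the set of $p\times q$ matrices with entries in $\mathcal{D}'$, multiplied in the usual way. For a left $\mathcal{D}'$-module $A$, elements $X\in A^{q}$ are columns and a matrix $\mathcal{M}\in\mathcal{D}'(p\times q)$ acts by $(\mathcal{M}X)_i=\sum_{j=1}^q\mathcal{M}_{ij}X_j$. *)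

theory Defs
  imports
    "HOL-Analysis.Analysis"
    "HOL-Complex_Analysis.Complex_Analysis"
    "HOL-Computational_Algebra.Polynomial"
    "HOL-Library.Function_Algebras"
begin

section \<open>Smooth functions on subsets of Euclidean space\<close>

primrec Ck_on :: "nat \<Rightarrow> 'a::euclidean_space set \<Rightarrow> ('a \<Rightarrow> 'b::real_normed_vector) \<Rightarrow> bool" where
  "Ck_on 0 U f \<longleftrightarrow> continuous_on U f"
| "Ck_on (Suc k) U f \<longleftrightarrow>
     (\<forall>x\<in>U. f differentiable (at x)) \<and>
     (\<forall>b\<in>Basis. Ck_on k U (\<lambda>x. frechet_derivative f (at x) b))"

text \<open>Smoothness on an arbitrary set means the existence of local smooth extensions. This covers
  manifolds with boundary and submanifolds embedded in Euclidean space.\<close>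

definition smooth_on :: "'a::euclidean_space set \<Rightarrow> ('a \<Rightarrow> 'b::real_normed_vector) \<Rightarrow> bool" where
  "smooth_on X f \<longleftrightarrow>
     (\<forall>x\<in>X. \<exists>U g. open U \<and> x \<in> U \<and> (\<forall>k. Ck_on k U g) \<and> (\<forall>y\<in>U \<inter> X. g y = f y))"

text \<open>A function on \<open>X\<close> is represented by the total function that vanishes outside \<open>X\<close>.\<close>

definition Cinf :: "'a::euclidean_space set \<Rightarrow> ('a \<Rightarrow> complex) set" where
  "Cinf X = {f. smooth_on X f \<and> (\<forall>z. z \<notin> X \<longrightarrow> f z = 0)}"

definition Cinf_c :: "'a::euclidean_space set \<Rightarrow> ('a \<Rightarrow> complex) set" where
  "Cinf_c X = {f \<in> Cinf X. \<exists>K. compact K \<and> K \<subseteq> X \<and> (\<forall>z. z \<notin> K \<longrightarrow> f z = 0)}"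

text \<open>Derivatives along lines inside \<open>S\<close>; they are one-sided at boundary points of \<open>S\<close>.\<close>

definition partial_on :: "'a::real_normed_vector set \<Rightarrow> 'a \<Rightarrow> ('a \<Rightarrow> complex) \<Rightarrow> 'a \<Rightarrow> complex" where
  "partial_on S b f = (\<lambda>z. vector_derivative (\<lambda>s. f (z + s *\<^sub>R b)) (at 0 within {s. z + s *\<^sub>R b \<in> S}))"

definition partials_on :: "'a::real_normed_vector set \<Rightarrow> 'a list \<Rightarrow> ('a \<Rightarrow> complex) \<Rightarrow> 'a \<Rightarrow> complex" where
  "partials_on S bs f = foldr (partial_on S) bs f"


section \<open>The model half-space\<close>

text \<open>Points \<open>(x, t)\<close> and covectors \<open>(\<xi>, \<eta>)\<close>. Functions of \<open>x'\<close> or of \<open>\<xi>'\<close> live on the hyperplane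
  \<open>x\<^sub>n = 0\<close> of the same space, so that the case of dimension one needs no separate treatment.\<close>

type_synonym 'n pt = "(real^'n) \<times> real"

text \<open>Which coordinate of the model space is called \<open>x\<^sub>n\<close> is immaterial.\<close>

definition nrm :: "'n::finite" where
  "nrm = (SOME i. True)"

definition e_nrm :: "real^'n::finite" where
  "e_nrm = axis nrm 1"

definition tang :: "real^'n::finite \<Rightarrow> real^'n" where
  "tang x = (\<chi> i. if i = nrm then 0 else x $ i)"

definition hyperplane :: "(real^'n::finite) set" where
  "hyperplane = {x. x $ nrm = 0}"

definition half_space :: "(real^'n::finite) set" where
  "half_space = {x. 0 \<le> x $ nrm}"

text \<open>\<open>cyl G'\<close> and \<open>cyl_int G'\<close> are the products of \<open>G'\<close> with the closed and the open half-line.\<close>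

definition cyl :: "(real^'n::finite) set \<Rightarrow> (real^'n) set" where
  "cyl G' = {x. tang x \<in> G' \<and> 0 \<le> x $ nrm}"

definition cyl_int :: "(real^'n::finite) set \<Rightarrow> (real^'n) set" where
  "cyl_int G' = {x. tang x \<in> G' \<and> 0 < x $ nrm}"

text \<open>Lebesgue measure on the hyperplane (a point mass in dimension one).\<close>

definition lborel_hyp :: "(real^'n::finite) measure" where
  "lborel_hyp = distr (\<Pi>\<^sub>M i\<in>-{nrm}. lborel) borel (\<lambda>f. \<chi> i. if i = nrm then 0 else f i)"

abbreviation lebR :: "'n::finite pt measure" where
  "lebR \<equiv> lborel"

abbreviation lebH :: "'n::finite pt measure" where
  "lebH \<equiv> lborel_hyp \<Otimes>\<^sub>M lborel"

text \<open>The extension by zero \<open>e\<^sup>+\<close> does not appear explicitly below, since functions on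
  \<open>cyl G' \<times> \<Delta>\<close> already vanish outside that set.\<close>

definition fourier :: "'n::finite pt measure \<Rightarrow> ('n pt \<Rightarrow> complex) \<Rightarrow> 'n pt \<Rightarrow> complex" where
  "fourier M u \<zeta> = (LINT z|M. cis (- (z \<bullet> \<zeta>)) * u z)"


section \<open>Anisotropic symbols\<close>

definition rho :: "real \<Rightarrow> 'n::finite pt \<Rightarrow> real" where
  "rho \<nu> \<zeta> = sqrt (1 + (norm (fst \<zeta>))\<^sup>2 + \<bar>snd \<zeta>\<bar> powr (2 / \<nu>))"

text \<open>Index sets \<open>I\<close> and \<open>J\<close> tell which coordinates of \<open>x\<close> and of \<open>\<xi>\<close> are present: all of them
  (\<open>UNIV\<close>) or only the tangential ones (\<open>-{nrm}\<close>).\<close>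

definition covars :: "'n::finite set \<Rightarrow> 'n pt set" where
  "covars J = {\<zeta>. \<forall>i. i \<notin> J \<longrightarrow> fst \<zeta> $ i = 0}"

text \<open>Multi-indices are lists of coordinate indices; the length of the list is the order.\<close>

definition symbol_dirs :: "'n::finite list \<Rightarrow> nat \<Rightarrow> 'n list \<Rightarrow> nat \<Rightarrow> ('n pt \<times> 'n pt) list" where
  "symbol_dirs \<alpha> j \<beta> l =
     map (\<lambda>i. ((axis i 1, 0), 0)) \<alpha> @ replicate j ((0, 1), 0) @
     map (\<lambda>i. (0, (axis i 1, 0))) \<beta> @ replicate l (0, (0, 1))"

definition seminorm_le ::
  "real \<Rightarrow> real \<Rightarrow> 'n::finite pt set \<Rightarrow> 'n set \<Rightarrow> 'n pt set \<Rightarrow> 'n list \<Rightarrow> nat \<Rightarrow> 'n list \<Rightarrow> nat \<Rightarrow>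
   ('n pt \<times> 'n pt \<Rightarrow> complex) \<Rightarrow> real \<Rightarrow> bool" where
  "seminorm_le \<nu> m X J H \<alpha> j \<beta> l a C \<longleftrightarrow>
     (\<forall>z\<in>H. \<forall>\<zeta>\<in>covars J.
        norm (partials_on (X \<times> covars J) (symbol_dirs \<alpha> j \<beta> l) a (z, \<zeta>))
          \<le> C * rho \<nu> \<zeta> powr (m - real (length \<beta>) - \<nu> * real l))"

definition symbols ::
  "real \<Rightarrow> real \<Rightarrow> 'n::finite set \<Rightarrow> 'n pt set \<Rightarrow> 'n set \<Rightarrow> ('n pt \<times> 'n pt \<Rightarrow> complex) set" where
  "symbols \<nu> m I X J =
     {a. smooth_on (X \<times> covars J) a \<and>
         (\<forall>H \<alpha> j \<beta> l. compact H \<and> H \<subseteq> X \<and> set \<alpha> \<subseteq> I \<and> set \<beta> \<subseteq> J \<longrightarrow>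
            (\<exists>C. seminorm_le \<nu> m X J H \<alpha> j \<beta> l a C))}"

text \<open>\<open>sz\<close> measures the size of the index: \<open>\<bar>k\<bar>\<close>, or \<open>j + l\<close> for double sequences.\<close>

definition rapidly_decreasing ::
  "('k \<Rightarrow> real) \<Rightarrow> real \<Rightarrow> real \<Rightarrow> 'n::finite set \<Rightarrow> 'n pt set \<Rightarrow> 'n set \<Rightarrow>
   ('k \<Rightarrow> 'n pt \<times> 'n pt \<Rightarrow> complex) \<Rightarrow> bool" where
  "rapidly_decreasing sz \<nu> m I X J a \<longleftrightarrow>
     (\<forall>k. a k \<in> symbols \<nu> m I X J) \<and>
     (\<forall>H \<alpha> j \<beta> l. compact H \<and> H \<subseteq> X \<and> set \<alpha> \<subseteq> I \<and> set \<beta> \<subseteq> J \<longrightarrow>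
        (\<forall>M::nat. \<exists>C. \<forall>k. seminorm_le \<nu> m X J H \<alpha> j \<beta> l (a k) (C / (1 + sz k) ^ M)))"

abbreviation size_int :: "int \<Rightarrow> real" where "size_int k \<equiv> real_of_int \<bar>k\<bar>"
abbreviation size_pair :: "nat \<times> nat \<Rightarrow> real" where "size_pair jl \<equiv> real (fst jl + snd jl)"

abbreviation "symb_full \<nu> m G' \<Delta> \<equiv> symbols \<nu> m UNIV (cyl G' \<times> \<Delta>) UNIV"
abbreviation "symb_tang \<nu> m G' \<Delta> \<equiv> symbols \<nu> m (-{nrm}) (G' \<times> \<Delta>) (-{nrm})"
abbreviation "rapid_tang sz \<nu> m G' \<Delta> \<equiv> rapidly_decreasing sz \<nu> m (-{nrm}) (G' \<times> \<Delta>) (-{nrm})"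
abbreviation "rapid_half sz \<nu> m G' \<Delta> \<equiv> rapidly_decreasing sz \<nu> m UNIV (cyl G' \<times> \<Delta>) (-{nrm})"

definition lag :: "real \<Rightarrow> int \<Rightarrow> complex \<Rightarrow> complex" where
  "lag r k z = (of_real r - \<i> * z) powi k / (of_real r + \<i> * z) powi (k + 1)"

definition tangv :: "'n::finite pt \<Rightarrow> 'n pt" where
  "tangv z = (tang (fst z), snd z)"

definition xn :: "'n::finite pt \<Rightarrow> real" where
  "xn z = fst z $ nrm"

text \<open>The covector with tangential part \<open>\<xi>'\<close>, normal component \<open>s\<close>, and the same \<open>\<eta>\<close>.\<close>

definition with_normal :: "'n::finite pt \<Rightarrow> real \<Rightarrow> 'n pt" where
  "with_normal \<zeta> s = (tang (fst \<zeta>) + s *\<^sub>R e_nrm, snd \<zeta>)"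

definition transmission ::
  "real \<Rightarrow> int \<Rightarrow> (real^'n::finite) set \<Rightarrow> real set \<Rightarrow> ('n pt \<times> 'n pt \<Rightarrow> complex) \<Rightarrow> bool" where
  "transmission \<nu> m G' \<Delta> a \<longleftrightarrow>
     (\<forall>\<gamma>::nat. \<exists>\<alpha> c.
        (\<forall>p. int p \<le> m \<longrightarrow> \<alpha> p \<in> symb_tang \<nu> (of_int m - real p) G' \<Delta>) \<and>
        rapid_tang size_int \<nu> (of_int m + 1) G' \<Delta> c \<and>
        (\<forall>z\<in>G' \<times> \<Delta>. \<forall>\<zeta>.
           ((\<lambda>k::int. c k (z, tangv \<zeta>) * lag (rho \<nu> (tangv \<zeta>)) k (of_real (xn \<zeta>))) has_sum
              (partials_on ((cyl G' \<times> \<Delta>) \<times> UNIV) (replicate \<gamma> ((e_nrm, 0), 0)) a (z, \<zeta>)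
               - (\<Sum>p\<in>{p. int p \<le> m}. \<alpha> p (z, tangv \<zeta>) * of_real (xn \<zeta>) ^ p))) UNIV))"

definition psdo_symbols where
  "psdo_symbols \<nu> m G' \<Delta> = {a \<in> symb_full \<nu> (of_int m) G' \<Delta>. transmission \<nu> m G' \<Delta> a}"

definition potential_symbols ::
  "real \<Rightarrow> int \<Rightarrow> (real^'n::finite) set \<Rightarrow> real set \<Rightarrow> ('n pt \<times> 'n pt \<Rightarrow> complex) set" where
  "potential_symbols \<nu> m G' \<Delta> =
     {\<kappa>. \<exists>c. rapid_half real \<nu> (of_int m + 1) G' \<Delta> c \<and>
        (\<forall>z\<in>cyl G' \<times> \<Delta>. \<forall>\<zeta>.
           ((\<lambda>k::nat. c k (z, tangv \<zeta>) * lag (rho \<nu> (tangv \<zeta>)) (int k) (of_real (xn \<zeta>)))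
              has_sum \<kappa> (z, \<zeta>)) UNIV)}"

definition trace_symbols ::
  "real \<Rightarrow> int \<Rightarrow> nat \<Rightarrow> (real^'n::finite) set \<Rightarrow> real set \<Rightarrow> ('n pt \<times> 'n pt \<Rightarrow> complex) set" where
  "trace_symbols \<nu> m d G' \<Delta> =
     {\<tau>. \<exists>\<alpha> c. (\<forall>p<d. \<alpha> p \<in> symb_tang \<nu> (of_int m - real p) G' \<Delta>) \<and>
        rapid_tang real \<nu> (of_int m + 1) G' \<Delta> c \<and>
        (\<forall>z\<in>G' \<times> \<Delta>. \<forall>\<zeta>.
           ((\<lambda>k::nat. c k (z, tangv \<zeta>) * lag (rho \<nu> (tangv \<zeta>)) (int k) (- of_real (xn \<zeta>))) has_sum
              (\<tau> (z, \<zeta>) - (\<Sum>p<d. \<alpha> p (z, tangv \<zeta>) * of_real (xn \<zeta>) ^ p))) UNIV)}"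

text \<open>A Green symbol takes \<open>(x, t)\<close>, \<open>(\<xi>, \<eta>)\<close> and, as last argument, \<open>\<zeta>\<^sub>n\<close>.\<close>

definition green_symbols ::
  "real \<Rightarrow> int \<Rightarrow> nat \<Rightarrow> (real^'n::finite) set \<Rightarrow> real set \<Rightarrow> ('n pt \<times> 'n pt \<Rightarrow> real \<Rightarrow> complex) set" where
  "green_symbols \<nu> m d G' \<Delta> =
     {b. \<exists>\<kappa> c. (\<forall>p<d. \<kappa> p \<in> potential_symbols \<nu> (m - int p) G' \<Delta>) \<and>
        rapid_tang size_pair \<nu> (of_int m + 2) G' \<Delta> c \<and>
        (\<forall>z\<in>cyl G' \<times> \<Delta>. \<forall>\<zeta> s.
           ((\<lambda>(j, l). c (j, l) (tangv z, tangv \<zeta>)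
                 * lag (rho \<nu> (tangv \<zeta>)) (int j) (of_real (xn \<zeta>))
                 * lag (rho \<nu> (tangv \<zeta>)) (int l) (- of_real s)) has_sum
              (b (z, \<zeta>) s - (\<Sum>p<d. \<kappa> p (z, \<zeta>) * of_real s ^ p))) UNIV)}"

definition boundary_symbols where
  "boundary_symbols \<nu> m G' \<Delta> = symb_tang \<nu> (of_int m) G' \<Delta>"


section \<open>The plus-integral\<close>

definition upper_semicircle :: "real \<Rightarrow> real \<Rightarrow> complex" where
  "upper_semicircle R = linepath (- of_real R) (of_real R) +++ part_circlepath 0 R 0 pi"

definition has_contour_plus :: "(complex \<Rightarrow> complex) \<Rightarrow> complex \<Rightarrow> bool" where
  "has_contour_plus f I \<longleftrightarrow> ((\<lambda>R. contour_integral (upper_semicircle R) f) \<longlongrightarrow> I) at_top"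

text \<open>The functional is given by the contour limit on polynomials and on the rational functions
  \<open>lag r k\<close>, and is extended by continuity to sums of a polynomial and a series
  \<open>\<Sum>k. a k * lag r k\<close> with rapidly decreasing coefficients. The extension is necessary: if \<open>v\<close> has
  compact support, then the Fourier transform of \<open>e\<^sup>+ v\<close> in the normal variable is entire, and its
  literal contour integral vanishes by Cauchy's theorem, whereas the extended functional gives
  \<open>2 \<pi>\<close> times the boundary value \<open>v 0\<close>.\<close>

definition has_plus_integral :: "(real \<Rightarrow> complex) \<Rightarrow> complex \<Rightarrow> bool" where
  "has_plus_integral f I \<longleftrightarrow>
     (\<exists>r>0. \<exists>(q::complex poly) (a::int \<Rightarrow> complex) I\<^sub>q (I\<^sub>k::int \<Rightarrow> complex).
        (\<forall>M::nat. \<exists>C. \<forall>k. norm (a k) \<le> C / (1 + size_int k) ^ M) \<and>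
        (\<forall>s. ((\<lambda>k. a k * lag r k (of_real s)) has_sum (f s - poly q (of_real s))) UNIV) \<and>
        has_contour_plus (poly q) I\<^sub>q \<and>
        (\<forall>k. has_contour_plus (lag r k) (I\<^sub>k k)) \<and>
        ((\<lambda>k. a k * I\<^sub>k k) has_sum (I - I\<^sub>q)) UNIV)"

definition plus_integral :: "(real \<Rightarrow> complex) \<Rightarrow> complex" where
  "plus_integral f = (THE I. has_plus_integral f I)"


section \<open>Operators in local coordinates\<close>

text \<open>\<open>u(z) = c * \<integral> exp(i z \<cdot> \<zeta>) s(z, \<zeta>) d\<zeta>\<close> as an oscillatory integral on \<open>X\<close>, that is, as a
  distribution: the equation is tested with \<open>\<phi>\<close> and the integration over \<open>z\<close> comes first, which
  makes the integral over \<open>\<zeta>\<close> absolutely convergent. In the first three cases below \<open>X\<close> is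
  contained in \<open>x\<^sub>n > 0\<close>, which is the restriction \<open>r\<^sup>+\<close>.\<close>

definition osc_integral ::
  "'n::finite pt measure \<Rightarrow> real \<Rightarrow> 'n pt set \<Rightarrow> ('n pt \<times> 'n pt \<Rightarrow> complex) \<Rightarrow> ('n pt \<Rightarrow> complex) \<Rightarrow> bool" where
  "osc_integral M c X s u \<longleftrightarrow>
     (\<forall>\<phi>\<in>Cinf_c X.
        (LINT z|M. u z * \<phi> z) = of_real c * (LINT \<zeta>|M. LINT z|M. cis (z \<bullet> \<zeta>) * s (z, \<zeta>) * \<phi> z))"

definition cR :: "'n::finite itself \<Rightarrow> real" where
  "cR _ = 1 / (2 * pi) ^ (CARD('n) + 1)"

definition cH :: "'n::finite itself \<Rightarrow> real" where
  "cH _ = 1 / (2 * pi) ^ CARD('n)"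

definition is_interior_op where
  "is_interior_op G' \<Delta> a b F \<longleftrightarrow>
     (\<forall>v\<in>Cinf_c (cyl G' \<times> \<Delta>).
        osc_integral lebR (cR TYPE('n::finite)) (cyl_int G' \<times> interior \<Delta>)
          (\<lambda>(z::'n pt, \<zeta>). a (z, \<zeta>) * fourier lebR v \<zeta> +
             plus_integral (\<lambda>s. b (z, \<zeta>) s * fourier lebR v (with_normal \<zeta> s)))
          (F v))"

definition is_potential_op where
  "is_potential_op G' \<Delta> \<kappa> F \<longleftrightarrow>
     (\<forall>w\<in>Cinf_c (G' \<times> \<Delta>).
        osc_integral lebR (cR TYPE('n::finite)) (cyl_int G' \<times> interior \<Delta>)
          (\<lambda>(z::'n pt, \<zeta>). \<kappa> (z, \<zeta>) * fourier lebH w (tangv \<zeta>))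
          (F w))"

definition is_trace_op where
  "is_trace_op G' \<Delta> \<tau> F \<longleftrightarrow>
     (\<forall>v\<in>Cinf_c (cyl G' \<times> \<Delta>).
        osc_integral lebH (cH TYPE('n::finite)) (G' \<times> interior \<Delta>)
          (\<lambda>(z::'n pt, \<zeta>). plus_integral (\<lambda>s. \<tau> (z, with_normal \<zeta> s) * fourier lebR v (with_normal \<zeta> s)))
          (F v))"

definition is_boundary_op where
  "is_boundary_op G' \<Delta> q F \<longleftrightarrow>
     (\<forall>w\<in>Cinf_c (G' \<times> \<Delta>).
        osc_integral lebH (cH TYPE('n::finite)) (G' \<times> interior \<Delta>)
          (\<lambda>(z::'n pt, \<zeta>). q (z, \<zeta>) * fourier lebH w \<zeta>)
          (F w))"


section \<open>The manifold\<close>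

definition bdry_chart :: "(real^'n::finite) set \<Rightarrow> (real^'n) set \<Rightarrow> (real^'n \<Rightarrow> real^'n) \<Rightarrow> bool" where
  "bdry_chart G U \<theta> \<longleftrightarrow>
     openin (top_of_set (closure G)) U \<and> openin (top_of_set half_space) (\<theta> ` U) \<and> inj_on \<theta> U \<and>
     smooth_on U \<theta> \<and> smooth_on (\<theta> ` U) (inv_into U \<theta>) \<and>
     (\<forall>x\<in>U. x \<in> frontier G \<longleftrightarrow> \<theta> x \<in> hyperplane)"

definition smooth_manifold_with_boundary :: "(real^'n::finite) set \<Rightarrow> bool" where
  "smooth_manifold_with_boundary G \<longleftrightarrow> (\<forall>x\<in>closure G. \<exists>U \<theta>. bdry_chart G U \<theta> \<and> x \<in> U)"

text \<open>The transition between the boundary parts of two charts, extended by the identity in the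
  normal direction; its Jacobian determinant is that of the transition in the hyperplane.\<close>

definition bdry_transition ::
  "(real^'n::finite) set \<Rightarrow> (real^'n \<Rightarrow> real^'n) \<Rightarrow> (real^'n \<Rightarrow> real^'n) \<Rightarrow> real^'n \<Rightarrow> real^'n" where
  "bdry_transition U \<theta> \<theta>' y = \<theta>' (inv_into U \<theta> (tang y)) + (y $ nrm) *\<^sub>R e_nrm"

definition orientable_boundary :: "(real^'n::finite) set \<Rightarrow> bool" where
  "orientable_boundary G \<longleftrightarrow>
     (\<exists>\<A>. (\<forall>(U, \<theta>)\<in>\<A>. bdry_chart G U \<theta>) \<and> frontier G \<subseteq> (\<Union>(U, \<theta>)\<in>\<A>. U) \<and>
        (\<forall>(U, \<theta>)\<in>\<A>. \<forall>(V, \<theta>')\<in>\<A>. \<forall>x\<in>U \<inter> V \<inter> frontier G.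
           0 < det (matrix (frechet_derivative (bdry_transition U \<theta> \<theta>') (at (\<theta> x))))))"


section \<open>Proper boundary value operators\<close>

text \<open>An element of \<open>\<R>\<close> is a pair of functions on \<open>closure G \<times> \<Delta>\<close> and \<open>frontier G \<times> \<Delta>\<close>. An
  operator on \<open>\<R>\<close> is represented by a total map that is zero outside \<open>\<R>\<close>, so that addition of
  operators is pointwise addition and the product is \<open>\<circ>\<close>.\<close>

type_synonym 'n fn = "'n pt \<Rightarrow> complex"
type_synonym 'n bv_operator = "'n fn \<times> 'n fn \<Rightarrow> 'n fn \<times> 'n fn"

definition bv_space :: "(real^'n::finite) set \<Rightarrow> real set \<Rightarrow> ('n fn \<times> 'n fn) set" where
  "bv_space G \<Delta> = Cinf (closure G \<times> \<Delta>) \<times> Cinf (frontier G \<times> \<Delta>)"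

definition cscale :: "complex \<Rightarrow> 'n fn \<times> 'n fn \<Rightarrow> 'n fn \<times> 'n fn" where
  "cscale c r = (\<lambda>z. c * fst r z, \<lambda>z. c * snd r z)"

definition linear_endo :: "(real^'n::finite) set \<Rightarrow> real set \<Rightarrow> 'n bv_operator \<Rightarrow> bool" where
  "linear_endo G \<Delta> P \<longleftrightarrow>
     (\<forall>r\<in>bv_space G \<Delta>. P r \<in> bv_space G \<Delta>) \<and> (\<forall>r. r \<notin> bv_space G \<Delta> \<longrightarrow> P r = 0) \<and>
     (\<forall>r\<in>bv_space G \<Delta>. \<forall>r'\<in>bv_space G \<Delta>. P (r + r') = P r + P r') \<and>
     (\<forall>c. \<forall>r\<in>bv_space G \<Delta>. P (cscale c r) = cscale c (P r))"

definition entry11 :: "'n bv_operator \<Rightarrow> 'n fn \<Rightarrow> 'n fn" where "entry11 P u = fst (P (u, 0))"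
definition entry12 :: "'n bv_operator \<Rightarrow> 'n fn \<Rightarrow> 'n fn" where "entry12 P w = fst (P (0, w))"
definition entry21 :: "'n bv_operator \<Rightarrow> 'n fn \<Rightarrow> 'n fn" where "entry21 P u = snd (P (u, 0))"
definition entry22 :: "'n bv_operator \<Rightarrow> 'n fn \<Rightarrow> 'n fn" where "entry22 P w = snd (P (0, w))"

text \<open>The support of the Schwartz kernel of \<open>F\<close>, as a map from functions on \<open>Y\<close> to functions
  on \<open>X\<close>: \<open>(x, y)\<close> lies outside it iff, for some neighbourhoods \<open>V\<close> of \<open>y\<close> and \<open>U\<close> of \<open>x\<close>, all
  test functions supported in \<open>V\<close> are mapped to functions vanishing on \<open>U\<close>.\<close>

definition kernel_support :: "'n::finite pt set \<Rightarrow> 'n pt set \<Rightarrow> ('n fn \<Rightarrow> 'n fn) \<Rightarrow> ('n pt \<times> 'n pt) set" where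
  "kernel_support X Y F =
     {(x, y) \<in> X \<times> Y. \<forall>U V. openin (top_of_set X) U \<and> x \<in> U \<and> openin (top_of_set Y) V \<and> y \<in> V \<longrightarrow>
        (\<exists>v\<in>Cinf_c Y. (\<forall>z. z \<notin> V \<longrightarrow> v z = 0) \<and> (\<exists>x'\<in>U. F v x' \<noteq> 0))}"

text \<open>The last clause says that the values on functions without compact support are the ones
  determined by the kernel.\<close>

definition proper_support :: "'n::finite pt set \<Rightarrow> 'n pt set \<Rightarrow> ('n fn \<Rightarrow> 'n fn) \<Rightarrow> bool" where
  "proper_support X Y F \<longleftrightarrow>
     proper_map (top_of_set (kernel_support X Y F)) (top_of_set X) fst \<and>
     proper_map (top_of_set (kernel_support X Y F)) (top_of_set Y) snd \<and>
     (\<forall>v\<in>Cinf Y. \<forall>x\<in>X.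
        (\<forall>y. (x, y) \<in> kernel_support X Y F \<longrightarrow> y \<notin> closure {z. v z \<noteq> 0}) \<longrightarrow> F v x = 0)"

text \<open>\<open>localize U \<theta> W V \<theta>' W' \<phi> \<psi> F\<close> is \<open>\<phi> F \<psi>\<close> in coordinates. The values are expressed in the chart
  \<open>\<theta>\<close> on \<open>U\<close>, and \<open>W\<close> is the part of \<open>U\<close> on which they live (\<open>U\<close> itself or \<open>U \<inter> frontier G\<close>); the
  arguments are expressed in the chart \<open>\<theta>'\<close> on \<open>V\<close>, and \<open>W'\<close> is the part of \<open>V\<close> on which they live.\<close>

definition localize ::
  "(real^'n::finite) set \<Rightarrow> (real^'n \<Rightarrow> real^'n) \<Rightarrow> (real^'n) set \<Rightarrow>
   (real^'n) set \<Rightarrow> (real^'n \<Rightarrow> real^'n) \<Rightarrow> (real^'n) set \<Rightarrow>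
   (real^'n \<Rightarrow> complex) \<Rightarrow> (real^'n \<Rightarrow> complex) \<Rightarrow> ('n fn \<Rightarrow> 'n fn) \<Rightarrow> 'n fn \<Rightarrow> 'n fn" where
  "localize U \<theta> W V \<theta>' W' \<phi> \<psi> F v =
     (let g = F (\<lambda>(x, t). if x \<in> W' then \<psi> x * v (\<theta>' x, t) else 0)
      in (\<lambda>(y, t). if y \<in> \<theta> ` W then \<phi> (inv_into U \<theta> y) * g (inv_into U \<theta> y, t) else 0))"

text \<open>For cut-off functions \<open>\<phi>\<close> and \<open>\<psi>\<close> supported in charts, \<open>\<phi> P \<psi>\<close> is given by the local formulas,
  provided that the two charts coincide or the supports of \<open>\<phi>\<close> and \<open>\<psi>\<close> are disjoint. This
  includes all products \<open>\<phi>\<^sub>j P \<phi>\<^sub>k\<close> for the members of a partition of unity such that any two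
  overlapping members are supported in a common chart.\<close>

definition locally_bv_operator ::
  "(real^'n::finite) set \<Rightarrow> real set \<Rightarrow> real \<Rightarrow> int \<Rightarrow> nat \<Rightarrow> 'n bv_operator \<Rightarrow> bool" where
  "locally_bv_operator G \<Delta> \<nu> m d P \<longleftrightarrow>
     (\<forall>U \<theta> V \<theta>' G'.
        bdry_chart G U \<theta> \<and> bdry_chart G V \<theta>' \<and>
        openin (top_of_set hyperplane) G' \<and> \<theta> ` U \<subseteq> cyl G' \<and> \<theta>' ` V \<subseteq> cyl G' \<longrightarrow>
        (\<forall>\<phi>\<in>Cinf_c U. \<forall>\<psi>\<in>Cinf_c V.
           (U, \<theta>) = (V, \<theta>') \<or> closure {x. \<phi> x \<noteq> 0} \<inter> closure {x. \<psi> x \<noteq> 0} = {} \<longrightarrow>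
           (let U\<^sub>0 = U \<inter> frontier G; V\<^sub>0 = V \<inter> frontier G in
              (\<exists>a\<in>psdo_symbols \<nu> m G' \<Delta>. \<exists>b\<in>green_symbols \<nu> m d G' \<Delta>.
                 is_interior_op G' \<Delta> a b (localize U \<theta> U V \<theta>' V \<phi> \<psi> (entry11 P))) \<and>
              (\<exists>\<kappa>\<in>potential_symbols \<nu> m G' \<Delta>.
                 is_potential_op G' \<Delta> \<kappa> (localize U \<theta> U V \<theta>' V\<^sub>0 \<phi> \<psi> (entry12 P))) \<and>
              (\<exists>\<tau>\<in>trace_symbols \<nu> m d G' \<Delta>.
                 is_trace_op G' \<Delta> \<tau> (localize U \<theta> U\<^sub>0 V \<theta>' V \<phi> \<psi> (entry21 P))) \<and>
              (\<exists>q\<in>boundary_symbols \<nu> m G' \<Delta>.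
                 is_boundary_op G' \<Delta> q (localize U \<theta> U\<^sub>0 V \<theta>' V\<^sub>0 \<phi> \<psi> (entry22 P))))))"

text \<open>This is the algebra \<open>\<D>\<close>. The symbol classes increase with the order \<open>m\<close> and the class \<open>d\<close>, so
  that one pair serves all entries and charts.\<close>

definition bv_operators :: "(real^'n::finite) set \<Rightarrow> real set \<Rightarrow> real \<Rightarrow> 'n bv_operator set" where
  "bv_operators G \<Delta> \<nu> =
     {P. linear_endo G \<Delta> P \<and>
         proper_support (closure G \<times> \<Delta>) (closure G \<times> \<Delta>) (entry11 P) \<and>
         proper_support (closure G \<times> \<Delta>) (frontier G \<times> \<Delta>) (entry12 P) \<and>
         proper_support (frontier G \<times> \<Delta>) (closure G \<times> \<Delta>) (entry21 P) \<and>
         proper_support (frontier G \<times> \<Delta>) (frontier G \<times> \<Delta>) (entry22 P) \<and>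
         (\<exists>m d. locally_bv_operator G \<Delta> \<nu> m d P)}"


section \<open>Subalgebras, modules, matrices\<close>

text \<open>The unit \<open>e\<close> is a unit of the subalgebra; it need not be the identity map of \<open>\<R>\<close>.\<close>

definition unital_subalgebra :: "'n bv_operator set \<Rightarrow> 'n bv_operator \<Rightarrow> 'n bv_operator set \<Rightarrow> bool" where
  "unital_subalgebra D' e D \<longleftrightarrow>
     D' \<subseteq> D \<and>
     (\<forall>P\<in>D'. \<forall>Q\<in>D'. P + Q \<in> D') \<and>
     (\<forall>c. \<forall>P\<in>D'. (\<lambda>r. cscale c (P r)) \<in> D') \<and>
     (\<forall>P\<in>D'. \<forall>Q\<in>D'. P \<circ> Q \<in> D') \<and>
     e \<in> D' \<and> (\<forall>P\<in>D'. e \<circ> P = P \<and> P \<circ> e = P)"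

definition left_unitary_module ::
  "'n bv_operator set \<Rightarrow> 'n bv_operator \<Rightarrow> ('n bv_operator \<Rightarrow> 'a \<Rightarrow> 'a::ab_group_add) \<Rightarrow> bool" where
  "left_unitary_module D' e act \<longleftrightarrow>
     (\<forall>P\<in>D'. \<forall>x y. act P (x + y) = act P x + act P y) \<and>
     (\<forall>P\<in>D'. \<forall>Q\<in>D'. \<forall>x. act (P + Q) x = act P x + act Q x) \<and>
     (\<forall>P\<in>D'. \<forall>Q\<in>D'. \<forall>x. act (P \<circ> Q) x = act P (act Q x)) \<and>
     (\<forall>x. act e x = x)"

text \<open>A \<open>p \<times> q\<close> matrix or a column of length \<open>q\<close> is a function on natural numbers, of which only
  the values at indices below the bounds matter.\<close>

definition matrices :: "'n bv_operator set \<Rightarrow> nat \<Rightarrow> nat \<Rightarrow> (nat \<Rightarrow> nat \<Rightarrow> 'n bv_operator) set" where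
  "matrices D' p q = {M. \<forall>i<p. \<forall>j<q. M i j \<in> D'}"

definition mat_prod ::
  "nat \<Rightarrow> (nat \<Rightarrow> nat \<Rightarrow> 'n bv_operator) \<Rightarrow> (nat \<Rightarrow> nat \<Rightarrow> 'n bv_operator) \<Rightarrow> nat \<Rightarrow> nat \<Rightarrow> 'n bv_operator" where
  "mat_prod q M N i k = (\<Sum>j<q. M i j \<circ> N j k)"

definition mat_act ::
  "('n bv_operator \<Rightarrow> 'a \<Rightarrow> 'a::ab_group_add) \<Rightarrow> nat \<Rightarrow> (nat \<Rightarrow> nat \<Rightarrow> 'n bv_operator) \<Rightarrow> (nat \<Rightarrow> 'a) \<Rightarrow> nat \<Rightarrow> 'a" where
  "mat_act act q M X i = (\<Sum>j<q. act (M i j) (X j))"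

text \<open>\<open>D'\<close>-parametrizability in \<open>A\<^sup>N\<close> of the control system \<open>L X = 0\<close> with an \<open>N\<^sub>1 \<times> N\<close> matrix \<open>L\<close>.\<close>

definition parametrizable ::
  "'n bv_operator set \<Rightarrow> ('n bv_operator \<Rightarrow> 'a \<Rightarrow> 'a::ab_group_add) \<Rightarrow> nat \<Rightarrow> nat \<Rightarrow>
   (nat \<Rightarrow> nat \<Rightarrow> 'n bv_operator) \<Rightarrow> bool" where
  "parametrizable D' act N\<^sub>1 N L \<longleftrightarrow>
     (\<exists>N'>0. \<exists>S\<in>matrices D' N N'. \<forall>X::nat \<Rightarrow> 'a.
        (\<forall>i<N\<^sub>1. mat_act act N L X i = 0) \<longleftrightarrow> (\<exists>X'. \<forall>i<N. X i = mat_act act N' S X' i))"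

end

theory Submission
  imports Defs
begin

text \<open>With \<open>S = I - P L\<close>, the equation \<open>L P L = L\<close> gives \<open>L S = 0\<close>, so every \<open>S X'\<close> is a solution;
  conversely \<open>L X = 0\<close> implies \<open>X = S X\<close>.\<close>

text \<open>The unit \<open>e\<close> supplies a member of \<open>D'\<close>, and scaling it by 0
  gives the zero operator.\<close>

lemma subalgebra_zero:
  assumes "unital_subalgebra D' e D"
  shows "0 \<in> D'"
proof -
  have "(\<lambda>r. cscale 0 (e r)) \<in> D'"
    using assms by (auto simp: unital_subalgebra_def)
  moreover have "(\<lambda>r. cscale 0 (e r)) = 0"
    by (simp add: cscale_def fun_eq_iff prod_eq_iff)
  ultimately show ?thesis by simp
qed

text \<open>Closure is assumed for sums and complex multiples only, so the difference is formed by
  scaling \<open>Q\<close> with -1.\<close>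

lemma subalgebra_diff:
  assumes "unital_subalgebra D' e D" "P \<in> D'" "Q \<in> D'"
  shows "P - Q \<in> D'"
proof -
  have "(\<lambda>r. cscale (- 1) (Q r)) \<in> D'"
    using assms by (auto simp: unital_subalgebra_def)
  moreover have "P - Q = P + (\<lambda>r. cscale (- 1) (Q r))"
    by (simp add: cscale_def fun_eq_iff prod_eq_iff)
  ultimately show ?thesis
    using assms unfolding unital_subalgebra_def by metis
qed

lemma subalgebra_sum:
  assumes "unital_subalgebra D' e D" "\<And>j. j \<in> I \<Longrightarrow> f j \<in> D'"
  shows "(\<Sum>j\<in>I. f j) \<in> D'"
  using assms(2)
proof (induction I rule: infinite_finite_induct)
  case (insert j I)
  then have "f j + (\<Sum>j\<in>I. f j) \<in> D'"
    using assms(1) unfolding unital_subalgebra_def by blast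
  then show ?case
    unfolding sum.insert[OF insert.hyps] .
\<comment> \<open>Over an empty or an infinite index set the sum is 0 by convention.\<close>
qed (use subalgebra_zero[OF assms(1)] in auto)

lemma mat_prod_in_matrices:
  assumes "unital_subalgebra D' e D" "M \<in> matrices D' p q" "N \<in> matrices D' q r"
  shows "mat_prod q M N \<in> matrices D' p r"
  unfolding matrices_def mat_prod_def
  using assms by (auto intro!: subalgebra_sum[OF assms(1)] simp: matrices_def unital_subalgebra_def)

lemma act_zero_left:
  assumes "unital_subalgebra D' e D" "left_unitary_module D' e act"
  shows "act 0 x = 0"
proof -
  have "act (0 + 0) x = act 0 x + act 0 x"
    using subalgebra_zero[OF assms(1)] assms(2) unfolding left_unitary_module_def by blast
  then show ?thesis by simp
qed

lemma act_diff_left: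
  assumes "unital_subalgebra D' e D" "left_unitary_module D' e act" "P \<in> D'" "Q \<in> D'"
  shows "act (P - Q) x = act P x - act Q x"
proof -
  \<comment> \<open>Additivity in the operator is assumed only on \<open>D'\<close>, so
    \<open>P - Q\<close> must itself lie in \<open>D'\<close> before \<open>act Q x\<close> can be
    cancelled.\<close>
  have "act (P - Q + Q) x = act (P - Q) x + act Q x"
    using subalgebra_diff[OF assms(1,3,4)] assms(2,4) unfolding left_unitary_module_def by blast
  then show ?thesis by simp
qed

lemma act_sum_left:
  assumes "unital_subalgebra D' e D" "left_unitary_module D' e act" "\<And>j. j \<in> I \<Longrightarrow> f j \<in> D'"
  shows "act (\<Sum>j\<in>I. f j) x = (\<Sum>j\<in>I. act (f j) x)"
  using assms(3)
proof (induction I rule: infinite_finite_induct)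
  case (insert j I)
  have "act (f j + (\<Sum>j\<in>I. f j)) x = act (f j) x + act (\<Sum>j\<in>I. f j) x"
    using assms(2) insert.prems subalgebra_sum[OF assms(1), of I f]
    unfolding left_unitary_module_def by blast
  moreover have "act (\<Sum>j\<in>I. f j) x = (\<Sum>j\<in>I. act (f j) x)"
    using insert.IH insert.prems by blast
  ultimately show ?case
    unfolding sum.insert[OF insert.hyps] by argo
qed (simp_all add: act_zero_left[OF assms(1,2)])

lemma act_zero_right:
  assumes "left_unitary_module D' e act" "P \<in> D'"
  shows "act P 0 = 0"
proof -
  have "act P (0 + 0) = act P 0 + act P 0"
    using assms unfolding left_unitary_module_def by blast
  then show ?thesis by simp
qed

lemma act_diff_right:
  assumes "left_unitary_module D' e act" "P \<in> D'"
  shows "act P (x - y) = act P x - act P y"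
proof -
  have "act P (x - y + y) = act P (x - y) + act P y"
    using assms unfolding left_unitary_module_def by blast
  then show ?thesis by simp
qed

lemma act_sum_right:
  assumes "left_unitary_module D' e act" "P \<in> D'"
  shows "act P (\<Sum>j\<in>I. f j) = (\<Sum>j\<in>I. act P (f j))"
proof (induction I rule: infinite_finite_induct)
  case (insert j I)
  have "act P (f j + (\<Sum>j\<in>I. f j)) = act P (f j) + act P (\<Sum>j\<in>I. f j)"
    using assms unfolding left_unitary_module_def by blast
  with insert show ?case by simp
qed (simp_all add: act_zero_right[OF assms])

lemma mat_act_diff:
  assumes "left_unitary_module D' e act" "M \<in> matrices D' p q" "i < p"
  shows "mat_act act q M (\<lambda>j. X j - Y j) i = mat_act act q M X i - mat_act act q M Y i"
  using assms
  by (simp add: mat_act_def matrices_def act_diff_right[OF assms(1)] flip: sum_subtractf)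

text \<open>This turns matrix identities over \<open>D'\<close> into identities between actions on
  columns. It combines additivity in both arguments with the module law for composition, entry by
  entry.\<close>

lemma mat_act_mat_prod:
  assumes D': "unital_subalgebra D' e D" and A: "left_unitary_module D' e act"
    and M: "M \<in> matrices D' p q" and N: "N \<in> matrices D' q r" and i: "i < p"
  shows "mat_act act r (mat_prod q M N) X i = mat_act act q M (mat_act act r N X) i"
proof -
  have mem: "M i j \<in> D'" "N j k \<in> D'" "M i j \<circ> N j k \<in> D'" if "j < q" "k < r" for j k
    using M N i that D' by (auto simp: matrices_def unital_subalgebra_def)
  have M_mem: "M i j \<in> D'" if "j < q" for j
    using M i that by (simp add: matrices_def)
  have "mat_act act r (mat_prod q M N) X i = (\<Sum>k<r. \<Sum>j<q. act (M i j \<circ> N j k) (X k))"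
    unfolding mat_act_def mat_prod_def
    by (intro sum.cong refl act_sum_left[OF D' A] mem) auto
  \<comment> \<open>Interchanging the finite sums puts the sum over \<open>k\<close> inside, where
    \<open>act (M i j)\<close> can then be pulled out of it.\<close>
  also have "\<dots> = (\<Sum>j<q. \<Sum>k<r. act (M i j) (act (N j k) (X k)))"
    using A mem by (subst sum.swap) (simp add: left_unitary_module_def)
  also have "\<dots> = mat_act act q M (mat_act act r N X) i"
    unfolding mat_act_def by (simp add: act_sum_right[OF A M_mem])
  finally show ?thesis .
qed

theorem theorem4:
  fixes G :: "(real^'n::finite) set" and \<Delta> :: "real set" and \<nu> :: real
    and D' :: "'n bv_operator set" and e :: "'n bv_operator"
    and act :: "'n bv_operator \<Rightarrow> 'a \<Rightarrow> 'a::ab_group_add"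
    and N N\<^sub>1 :: nat and L :: "nat \<Rightarrow> nat \<Rightarrow> 'n bv_operator"
  assumes "bounded G" and "open G"
    and "smooth_manifold_with_boundary G" and "orientable_boundary G"
    and "is_interval \<Delta>" and "interior \<Delta> \<noteq> {}"
    and "\<nu> > 0"
    and "unital_subalgebra D' e (bv_operators G \<Delta> \<nu>)"
    and "left_unitary_module D' e act"
    and "N > 0" and "N\<^sub>1 > 0"
    and "L \<in> matrices D' N\<^sub>1 N"
    and "\<exists>P\<in>matrices D' N N\<^sub>1. \<forall>i<N\<^sub>1. \<forall>j<N. mat_prod N\<^sub>1 (mat_prod N L P) L i j = L i j"
  shows "parametrizable D' act N\<^sub>1 N L"
proof -
  note D' = assms(8) and A = assms(9) and L = assms(12)
  obtain P where P: "P \<in> matrices D' N N\<^sub>1"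
    and LPL: "\<forall>i<N\<^sub>1. \<forall>j<N. mat_prod N\<^sub>1 (mat_prod N L P) L i j = L i j"
    using assms(13) by blast
  \<comment> \<open>The diagonal of the unit matrix carries \<open>e\<close>, the unit of
    \<open>D'\<close>, which may differ from the identity map of the function space.
    \<open>S\<close> is square, so the number of parameters is \<open>N\<close>.\<close>
  define S where "S = (\<lambda>i j. (if i = j then e else 0) - mat_prod N\<^sub>1 P L i j)"
  note LP_mem = mat_prod_in_matrices[OF D' L P]
    and PL_mem = mat_prod_in_matrices[OF D' P L]
  have S_mem: "S \<in> matrices D' N N"
    unfolding S_def matrices_def
    using PL_mem subalgebra_zero[OF D'] subalgebra_diff[OF D'] D'
    by (auto simp: matrices_def unital_subalgebra_def)
  have S_act: "mat_act act N S X i = X i - mat_act act N\<^sub>1 P (mat_act act N L X) i"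
    if "i < N" for X i
  proof -
    have "mat_act act N S X i =
        (\<Sum>j<N. act (if i = j then e else 0) (X j) - act (mat_prod N\<^sub>1 P L i j) (X j))"
      unfolding mat_act_def
    proof (rule sum.cong[OF refl])
      fix j assume "j \<in> {..<N}"
      then have "(if i = j then e else 0) \<in> D'" "mat_prod N\<^sub>1 P L i j \<in> D'"
        using that PL_mem subalgebra_zero[OF D'] D'
        by (auto simp: matrices_def unital_subalgebra_def)
      then show "act (S i j) (X j)
          = act (if i = j then e else 0) (X j) - act (mat_prod N\<^sub>1 P L i j) (X j)"
        unfolding S_def by (rule act_diff_left[OF D' A])
    qed
    \<comment> \<open>\<open>e\<close> acts as the identity because the module is unitary, and the
      off-diagonal zeros annihilate every element.\<close>
    also have "\<dots> = (\<Sum>j<N. if i = j then X j else 0) - mat_act act N (mat_prod N\<^sub>1 P L) X i"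
      using A act_zero_left[OF D' A] unfolding sum_subtractf mat_act_def
      by (intro arg_cong2[where f="(-)"] sum.cong) (auto simp: left_unitary_module_def)
    also have "\<dots> = X i - mat_act act N\<^sub>1 P (mat_act act N L X) i"
      using that mat_act_mat_prod[OF D' A P L that] by simp
    finally show ?thesis .
  qed
  have LPL_act: "mat_act act N L (mat_act act N\<^sub>1 P (mat_act act N L X)) i = mat_act act N L X i"
    if "i < N\<^sub>1" for X i
  proof -
    \<comment> \<open>The hypothesis equates entries only below the bounds; these are the only
      entries of row \<open>i\<close> that the action reads.\<close>
    have "mat_act act N L X i = mat_act act N (mat_prod N\<^sub>1 (mat_prod N L P) L) X i"
      using LPL that by (simp add: mat_act_def)
    also have "\<dots> = mat_act act N L (mat_act act N\<^sub>1 P (mat_act act N L X)) i"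
      using mat_act_mat_prod[OF D' A LP_mem L that] mat_act_mat_prod[OF D' A L P that] by simp
    finally show ?thesis by simp
  qed
  have "(\<forall>i<N\<^sub>1. mat_act act N L X i = 0) \<longleftrightarrow> (\<exists>X'. \<forall>i<N. X i = mat_act act N S X' i)" for X
  proof
    assume "\<forall>i<N\<^sub>1. mat_act act N L X i = 0"
    \<comment> \<open>\<open>P\<close> is applied to the column \<open>L X\<close>, whose first
      \<open>N\<^sub>1\<close> entries vanish; only the outer action is unfolded, so that the
      hypothesis can rewrite them.\<close>
    then have "mat_act act N\<^sub>1 P (mat_act act N L X) i = 0" if "i < N" for i
      using act_zero_right[OF A] P that by (simp add: mat_act_def[of _ N\<^sub>1] matrices_def)
    then show "\<exists>X'. \<forall>i<N. X i = mat_act act N S X' i"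
      \<comment> \<open>A solution serves as its own parameter, since \<open>S\<close> fixes
        it.\<close>
      using S_act by (intro exI[of _ X]) simp
  next
    assume "\<exists>X'. \<forall>i<N. X i = mat_act act N S X' i"
    then obtain X' where X': "\<forall>i<N. X i = mat_act act N S X' i" by blast
    show "\<forall>i<N\<^sub>1. mat_act act N L X i = 0"
    proof (intro allI impI)
      fix i assume i: "i < N\<^sub>1"
      \<comment> \<open>\<open>X\<close> and \<open>S X'\<close> are known to agree only below
        \<open>N\<close>, which suffices since \<open>L\<close> uses no further entries.\<close>
      have "mat_act act N L X i
          = mat_act act N L (\<lambda>j. X' j - mat_act act N\<^sub>1 P (mat_act act N L X') j) i"
        using X' S_act by (simp add: mat_act_def[of act N L])
      \<comment> \<open>By additivity this is \<open>L X' - L P L X'\<close>, and both terms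
        coincide.\<close>
      also have "\<dots> = 0"
        using mat_act_diff[OF A L i] LPL_act[OF i] by simp
      finally show "mat_act act N L X i = 0" .
    qed
  qed
  then show ?thesis
    unfolding parametrizable_def using S_mem \<open>N > 0\<close> by blast
qed

end
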